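(* Let $(v(n))_{n \geq 0}$ be the $\pm 1$ regular paperfolding sequence, defined by $v(2n) = (-1)^n$ and $v(2n+1) = v(n)$ for all $n \geq 0$. Then for every integer $d \geq 0$, $$\sum_{n \geq 0} \frac{v(n)}{(n+1)^{2d+1}} = \frac{\pi^{2d+1} |E_{2d}|}{(2^{2d+2}-2)(2d)!},$$ where the Euler numbers $E_{2n}$ are defined by $\frac{1}{\cosh t} = \sum_{n \geq 0} \frac{E_{2n}}{(2n)!} t^{2n}$ for $|t| < \frac{\pi}{2}$. *)

theory Defs
  imports "HOL-Complex_Analysis.Complex_Analysis"
begin

function paperfolding :: "nat \<Rightarrow> int" where
  "paperfolding n = (if even n then (- 1) ^ (n div 2) else paperfolding (n div 2))"
  by auto
termination
  by (relation "Wellfounded.measure (\<lambda>n. n)") (auto elim!: oddE)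

declare paperfolding.simps [simp del]

lemma paperfolding_double: "paperfolding (2 * n) = (- 1) ^ n"
  by (subst paperfolding.simps) simp

lemma paperfolding_double_Suc: "paperfolding (2 * n + 1) = paperfolding n"
  by (subst paperfolding.simps) simp

text \<open>
  The generating function determines only the values at even indices; those at odd
  indices are fixed to be \<open>0\<close>, as usual for Euler numbers.
\<close>

definition is_euler_numbers :: "(nat \<Rightarrow> real) \<Rightarrow> bool" where
  "is_euler_numbers E \<longleftrightarrow>
     (\<forall>n. odd n \<longrightarrow> E n = 0) \<and>
     (\<forall>t::real. \<bar>t\<bar> < pi / 2 \<longrightarrow> (\<lambda>n. E (2 * n) / fact (2 * n) * t ^ (2 * n)) sums (1 / cosh t))"

definition euler_number :: "nat \<Rightarrow> real" where
  "euler_number = (THE E. is_euler_numbers E)"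

text \<open>Existence and uniqueness, so that the definite description is meaningful.\<close>

lemma cosh_nonzero_ball:
  fixes z :: complex
  assumes "norm z < pi / 2"
  shows "cosh z \<noteq> 0"
proof
  assume "cosh z = 0"
  then obtain n :: int where n: "\<i> * z = complex_of_real (n * pi) + of_real pi / 2"
    unfolding cosh_conv_cos cos_eq_0 by blast
  have "norm z = norm (\<i> * z)"
    by (simp add: norm_mult)
  also have "\<i> * z = complex_of_real ((2 * n + 1) * (pi / 2))"
    by (subst n) (simp add: algebra_simps)
  also have "norm \<dots> = \<bar>of_int (2 * n + 1)\<bar> * (pi / 2)"
    unfolding norm_of_real by (simp add: abs_mult)
  finally have "norm z = \<bar>of_int (2 * n + 1)\<bar> * (pi / 2)" .
  moreover have "1 \<le> \<bar>2 * n + 1\<bar>" by presburger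
  then have "(1::real) \<le> \<bar>of_int (2 * n + 1)\<bar>"
    by linarith
  then have "1 * (pi / 2) \<le> \<bar>of_int (2 * n + 1)\<bar> * (pi / 2)"
    by (intro mult_right_mono) auto
  ultimately show False using assms by linarith
qed

lemma euler_numbers_exist: "\<exists>E. is_euler_numbers E"
proof -
  define f :: "complex \<Rightarrow> complex" where "f = (\<lambda>z. 1 / cosh z)"
  define a where "a = (\<lambda>n. (deriv ^^ n) f 0 / fact n)"
  define E where "E = (\<lambda>n. if even n then Re (a n) * fact n else 0)"
  have "f holomorphic_on ball 0 (pi / 2)"
    unfolding f_def cosh_conv_cos
    by (intro holomorphic_intros) (use cosh_nonzero_ball in \<open>auto simp: cosh_conv_cos\<close>)
  then have a: "(\<lambda>n. a n * z ^ n) sums f z" if "norm z < pi / 2" for z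
    using holomorphic_power_series[of f 0 "pi / 2" z] that by (simp add: a_def)
  have "(\<lambda>n. E (2 * n) / fact (2 * n) * t ^ (2 * n)) sums (1 / cosh t)"
    if t: "\<bar>t\<bar> < pi / 2" for t :: real
  proof -
    let ?z = "complex_of_real t"
    have "(\<lambda>n. a n * ?z ^ n + a n * (- ?z) ^ n) sums (f ?z + f (- ?z))"
      by (intro sums_add a) (use t in auto)
    then have "(\<lambda>n. (a n * ?z ^ n + a n * (- ?z) ^ n) / 2) sums ((f ?z + f (- ?z)) / 2)"
      by (rule sums_divide)
    moreover have "(f ?z + f (- ?z)) / 2 = complex_of_real (1 / cosh t)"
    proof -
      have "cosh ?z = complex_of_real (cosh t)"
        by (simp add: cosh_def exp_of_real[symmetric] scaleR_conv_of_real)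
      then show ?thesis by (simp add: f_def)
    qed
    moreover have "(\<lambda>n. (a n * ?z ^ n + a n * (- ?z) ^ n) / 2) =
        (\<lambda>n. if even n then a n * ?z ^ n else 0)"
      by (auto simp: fun_eq_iff)
    ultimately have "(\<lambda>n. if even n then a n * ?z ^ n else 0) sums complex_of_real (1 / cosh t)"
      by simp
    then have "(\<lambda>n. if even (2 * n) then a (2 * n) * ?z ^ (2 * n) else 0)
        sums complex_of_real (1 / cosh t)"
      by (subst sums_mono_reindex[of "\<lambda>n. 2 * n"]) (auto simp: strict_mono_def elim: evenE)
    then have "(\<lambda>n. Re (a (2 * n) * complex_of_real (t ^ (2 * n)))) sums Re (complex_of_real (1 / cosh t))"
      by (intro sums_Re) simp
    then show ?thesis
      unfolding Re_complex_of_real by (simp add: E_def)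
  qed
  then have "is_euler_numbers E"
    by (auto simp: is_euler_numbers_def E_def)
  then show ?thesis by blast
qed

lemma euler_numbers_unique:
  assumes "is_euler_numbers E" "is_euler_numbers F"
  shows "E = F"
proof
  fix m
  define c where "c = (\<lambda>n. (E n - F n) / fact n)"
  have c: "(\<lambda>n. c n * (t - 0) ^ n) sums 0" if "norm (t - 0) < pi / 2" for t :: real
  proof -
    have "(\<lambda>n. E (2 * n) / fact (2 * n) * t ^ (2 * n) - F (2 * n) / fact (2 * n) * t ^ (2 * n))
        sums (1 / cosh t - 1 / cosh t)"
      by (intro sums_diff) (use assms that in \<open>auto simp: is_euler_numbers_def\<close>)
    then have "(\<lambda>n. c (2 * n) * t ^ (2 * n)) sums 0"
      by (simp add: c_def diff_divide_distrib left_diff_distrib)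
    moreover have "c n = 0" if "n \<notin> range (\<lambda>k. 2 * k)" for n
    proof -
      have "odd n" using that by (auto elim: evenE)
      then show ?thesis using assms by (simp add: c_def is_euler_numbers_def)
    qed
    ultimately show ?thesis
      using sums_mono_reindex[of "\<lambda>n. 2 * n" "\<lambda>n. c n * t ^ n" 0]
      by (auto simp: strict_mono_def)
  qed
  have "c m = 0"
  proof (cases "m = 0")
    case True
    have "(\<lambda>n. c n * 0 ^ n) sums 0"
      using c[of 0] by simp
    then show ?thesis using True by (simp only: powser_sums_zero_iff)
  next
    case False
    show ?thesis
    proof (rule ccontr)
      assume "c m \<noteq> 0"
      then obtain s where s: "0 < s" "\<And>z::real. z \<in> cball 0 s - {0} \<Longrightarrow> (0::real) \<noteq> 0"
        using powser_0_nonzero[of "pi / 2" 0 c "\<lambda>_. 0" m] c False by auto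
      show False using s(1) s(2)[of s] by simp
    qed
  qed
  then show "E m = F m" by (simp add: c_def)
qed

lemma is_euler_numbers_euler_number: "is_euler_numbers euler_number"
  unfolding euler_number_def
  using euler_numbers_exist euler_numbers_unique theI'[of is_euler_numbers] by blast

end

theory Submission
  imports Defs
begin

text \<open>
  Splitting the series by the parity of \<open>n\<close> gives \<open>S = \<beta>(s) + S / 2 ^ s\<close>, where \<open>\<beta>\<close> is the
  Dirichlet beta function; for \<open>s = 1\<close> the series converges only conditionally, so this is done on
  partial sums. The values \<open>\<beta>(2 * d + 1)\<close> are the Taylor coefficients of the secant: the
  logarithmic derivative of Euler's reflection formula gives the partial fractions of the cotangent,
  hence those of the secant, and each fraction is expanded into a geometric series. Substituting an
  imaginary argument turns the secant into \<open>1 / cosh t\<close>.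
\<close>

section \<open>Null sequences from a halving recurrence\<close>

text \<open>Once \<open>e\<close> is known to be bounded, the recurrence forces its limsup in
  absolute value to be at most \<open>c\<close> times itself, because \<open>N div 2\<close> tends
  to infinity with \<open>N\<close>. Here \<open>e\<close> will be the error of the partial sums of
  the paperfolding series, so convergence itself is obtained this way.\<close>

lemma tendsto_0_halving_recurrence:
  fixes e \<delta> :: "nat \<Rightarrow> real"
  assumes \<delta>: "\<delta> \<longlonglongrightarrow> 0" and c: "0 \<le> c" "c < 1"
    and rec: "\<And>N. e N = \<delta> N + c * e (N div 2)"
  shows "e \<longlonglongrightarrow> 0"
proof -
  obtain K where K: "\<And>N. \<bar>\<delta> N\<bar> \<le> K"
    using Bseq_eq_bounded convergent_imp_Bseq[of \<delta>] \<delta>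
    unfolding Bseq_def convergent_def by (auto simp: real_norm_def)
  \<comment> \<open>The fixed point of a = K + c * a, so a bound by \<open>A\<close> passes from
    \<open>N div 2\<close> to \<open>N\<close>. At N = 0 the recurrence refers to itself and is
    solved for \<open>e 0\<close> directly.\<close>
  define A where "A = K / (1 - c)"
  have A: "K + c * A = A"
    using c by (simp add: A_def field_simps)
  have le: "\<bar>e N\<bar> \<le> \<bar>\<delta> N\<bar> + c * \<bar>e (N div 2)\<bar>" for N
    by (subst rec) (use c in \<open>simp add: abs_mult order_trans[OF abs_triangle_ineq]\<close>)
  have bound: "\<bar>e N\<bar> \<le> A" for N
  proof (induction N rule: less_induct)
    case (less N)
    show ?case
    proof (cases "N = 0")
      case True
      have "\<bar>e 0\<bar> * (1 - c) \<le> K"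
        using le[of 0] K[of 0] by (simp add: algebra_simps)
      then show ?thesis
        using c True by (simp add: A_def field_simps)
    next
      case False
      then have "c * \<bar>e (N div 2)\<bar> \<le> c * A"
        using c less by (intro mult_left_mono) auto
      then show ?thesis
        using le[of N] K[of N] A by linarith
    qed
  qed
  \<comment> \<open>Each use of the recurrence gains a factor \<open>c\<close> on the crude bound
    \<open>A\<close>; the other part stays fixed, since \<epsilon> * (1 - c) + c * \<epsilon> =
    \<epsilon>.\<close>
  have ev: "\<forall>\<^sub>F N in sequentially. \<bar>e N\<bar> \<le> \<epsilon> + c ^ J * A" if "\<epsilon> > 0" for \<epsilon> J
  proof (induction J)
    case 0
    show ?case
      using bound that by (intro always_eventually allI) (simp add: add_increasing less_imp_le)
  next
    case (Suc J)
    have "filterlim (\<lambda>N. N div 2) at_top (sequentially :: nat filter)"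
      unfolding filterlim_at_top
    proof
      fix Z :: nat
      show "\<forall>\<^sub>F N in sequentially. Z \<le> N div 2"
        using eventually_ge_at_top[of "2 * Z"] by eventually_elim linarith
    qed
    then have "\<forall>\<^sub>F N in sequentially. \<bar>e (N div 2)\<bar> \<le> \<epsilon> + c ^ J * A"
      by (rule eventually_compose_filterlim[OF Suc.IH])
    moreover have "\<forall>\<^sub>F N in sequentially. \<bar>\<delta> N\<bar> < \<epsilon> * (1 - c)"
      using order_tendstoD(2)[OF tendsto_rabs_zero[OF \<delta>], of "\<epsilon> * (1 - c)"] that c by simp
    ultimately show ?case
    proof eventually_elim
      case (elim N)
      have "c * \<bar>e (N div 2)\<bar> \<le> c * (\<epsilon> + c ^ J * A)"
        using elim c by (intro mult_left_mono) auto
      then show ?case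
        using le[of N] elim by (simp add: algebra_simps)
    qed
  qed
  show ?thesis
  proof (rule tendstoI)
    fix \<epsilon> :: real
    assume "\<epsilon> > 0"
    have "(\<lambda>J. c ^ J * A) \<longlonglongrightarrow> 0"
      using c by (intro tendsto_mult_left_zero LIMSEQ_power_zero) auto
    then have "\<forall>\<^sub>F J in sequentially. c ^ J * A < \<epsilon> / 2"
      using \<open>\<epsilon> > 0\<close> by (intro order_tendstoD) auto
    then obtain J where "c ^ J * A < \<epsilon> / 2"
      by (auto simp: eventually_sequentially)
    moreover have "\<forall>\<^sub>F N in sequentially. \<bar>e N\<bar> \<le> \<epsilon> / 2 + c ^ J * A"
      using ev \<open>\<epsilon> > 0\<close> by simp
    ultimately show "\<forall>\<^sub>F N in sequentially. dist (e N) 0 < \<epsilon>"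
      by (auto elim!: eventually_mono)
  qed
qed

section \<open>The Dirichlet beta function\<close>

definition dirichlet_beta :: "nat \<Rightarrow> real" where
  "dirichlet_beta s = (\<Sum>k. (- 1) ^ k / real (2 * k + 1) ^ s)"

lemma reciprocal_odd_power_decseq_null:
  fixes s :: nat
  assumes "s > 0"
  shows "(\<lambda>k. (1 / real (2 * k + 1)) ^ s) \<longlonglongrightarrow> 0"
    and "decseq (\<lambda>k. (1 / real (2 * k + 1)) ^ s)"
proof -
  have "(\<lambda>k. 1 / real (2 * k + 1)) \<longlonglongrightarrow> 0"
    by real_asymp
  from tendsto_power[OF this, of s] assms
  show "(\<lambda>k. (1 / real (2 * k + 1)) ^ s) \<longlonglongrightarrow> 0"
    by (simp add: power_0_left)
  show "decseq (\<lambda>k. (1 / real (2 * k + 1)) ^ s)"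
    by (intro decseq_SucI power_mono) (auto simp: field_simps)
qed

lemma dirichlet_beta_sums:
  assumes "s > 0"
  shows "(\<lambda>k. (- 1) ^ k / real (2 * k + 1) ^ s) sums dirichlet_beta s"
proof -
  have "summable (\<lambda>k. (- 1) ^ k * (1 / real (2 * k + 1)) ^ s)"
    using reciprocal_odd_power_decseq_null[OF assms]
    by (intro summable_Leibniz(1)) (auto simp: decseq_imp_monoseq)
  then show ?thesis
    unfolding dirichlet_beta_def by (simp add: summable_sums power_divide)
qed

text \<open>Grouping neighbouring terms of the alternating series makes every summand nonnegative.
  This gives the sign of beta and, even at s = 1, the absolute convergence used when summations are
  exchanged.\<close>

lemma dirichlet_beta_paired_sums:
  assumes "s > 0"
  shows "(\<lambda>n. 1 / real (4 * n + 1) ^ s - 1 / real (4 * n + 3) ^ s) sums dirichlet_beta s"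
proof -
  have "{n * 2..<n * 2 + 2} = {2 * n, 2 * n + 1}" for n :: nat
    by auto
  then show ?thesis
    using sums_group[OF dirichlet_beta_sums[OF assms], of 2]
    by (simp add: algebra_simps)
qed

lemma dirichlet_beta_nonneg:
  assumes "s > 0"
  shows "dirichlet_beta s \<ge> 0"
proof (rule sums_le[OF _ sums_zero dirichlet_beta_paired_sums[OF assms]])
  fix n
  show "0 \<le> 1 / real (4 * n + 1) ^ s - 1 / real (4 * n + 3) ^ s"
    by (simp add: frac_le power_mono)
qed

section \<open>Reduction of the paperfolding series to beta values\<close>

text \<open>Below \<open>N\<close> there are \<open>(N + 1) div 2\<close> even indices 2k, which
  carry the beta terms, and \<open>N div 2\<close> odd indices 2k + 1, whose denominators are powers
  of 2 * (k + 1) and so reproduce the series scaled by 1 / 2 ^ s.\<close>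

lemma paperfolding_partial_sum:
  fixes s N :: nat
  defines "S \<equiv> \<lambda>N. \<Sum>n<N. real_of_int (paperfolding n) / real (n + 1) ^ s"
  shows "S N = (\<Sum>k<(N + 1) div 2. (- 1) ^ k / real (2 * k + 1) ^ s) + S (N div 2) / 2 ^ s"
proof -
  have step: "S (2 * m) = (\<Sum>k<m. (- 1) ^ k / real (2 * k + 1) ^ s) + S m / 2 ^ s" for m
  proof (induction m)
    case 0
    show ?case by (simp add: S_def)
  next
    case (Suc m)
    have "S (2 * Suc m) = S (2 * m) + real_of_int (paperfolding (2 * m)) / real (2 * m + 1) ^ s
        + real_of_int (paperfolding (2 * m + 1)) / (2 * real (m + 1)) ^ s"
      by (simp add: S_def algebra_simps)
    also have "\<dots> = S (2 * m) + (- 1) ^ m / real (2 * m + 1) ^ s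
        + real_of_int (paperfolding m) / real (m + 1) ^ s / 2 ^ s"
      unfolding paperfolding_double paperfolding_double_Suc power_mult_distrib
      by (simp add: mult.commute)
    finally show ?case
      using Suc.IH by (simp add: S_def add_divide_distrib)
  qed
  show ?thesis
  proof (cases "even N")
    case True
    then show ?thesis
      using step by (auto elim!: evenE)
  next
    case False
    then obtain m where m: "N = 2 * m + 1"
      by (auto elim: oddE)
    have "S N = S (2 * m) + (- 1) ^ m / real (2 * m + 1) ^ s"
      unfolding m by (simp add: S_def paperfolding_double)
    then show ?thesis
      using step m by simp
  qed
qed

text \<open>The claimed value \<open>L\<close> is the fixed point of the limiting recurrence, so
  subtracting it from the partial sums leaves a halving recurrence with factor 1 / 2 ^ s and a null
  perturbation.\<close>

lemma paperfolding_dirichlet_series: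
  assumes "s > 0"
  shows "(\<lambda>n. real_of_int (paperfolding n) / real (n + 1) ^ s) sums
    (dirichlet_beta s / (1 - 1 / 2 ^ s))"
proof -
  define S where "S = (\<lambda>N. \<Sum>n<N. real_of_int (paperfolding n) / real (n + 1) ^ s)"
  define B where "B = (\<lambda>N. \<Sum>k<N. (- 1) ^ k / real (2 * k + 1) ^ s)"
  define L where "L = dirichlet_beta s / (1 - 1 / 2 ^ s)"
  have c: "(1::real) < 2 ^ s"
    using assms by (simp add: one_less_power)
  have L: "L = dirichlet_beta s + L / 2 ^ s"
    using c by (simp add: L_def field_simps)
  have "B \<longlonglongrightarrow> dirichlet_beta s"
    using dirichlet_beta_sums[OF assms] by (simp add: sums_def B_def)
  moreover have "filterlim (\<lambda>N. (N + 1) div 2) at_top (sequentially :: nat filter)"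
    unfolding filterlim_at_top
  proof
    fix Z :: nat
    show "\<forall>\<^sub>F N in sequentially. Z \<le> (N + 1) div 2"
      using eventually_ge_at_top[of "2 * Z"] by eventually_elim linarith
  qed
  ultimately have "(\<lambda>N. B ((N + 1) div 2)) \<longlonglongrightarrow> dirichlet_beta s"
    by (rule filterlim_compose)
  then have "(\<lambda>N. B ((N + 1) div 2) - dirichlet_beta s) \<longlonglongrightarrow> 0"
    by (simp add: LIM_zero_iff)
  then have "(\<lambda>N. S N - L) \<longlonglongrightarrow> 0"
  proof (rule tendsto_0_halving_recurrence)
    show "S N - L = B ((N + 1) div 2) - dirichlet_beta s + 1 / 2 ^ s * (S (N div 2) - L)" for N
      using paperfolding_partial_sum[of s N] L unfolding S_def B_def
      by (simp add: field_simps)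
  qed (use c in auto)
  then show ?thesis
    by (simp add: sums_def LIM_zero_iff S_def L_def)
qed

section \<open>Partial fractions of cotangent and secant\<close>

lemma sin_pi_times_neq_0:
  fixes z :: complex
  assumes "z \<notin> \<int>"
  shows "sin (of_real pi * z) \<noteq> 0"
proof
  assume "sin (of_real pi * z) = 0"
  then obtain n :: int where "of_real pi * z = of_real (n * pi)"
    unfolding sin_eq_0 by blast
  then have "of_real pi * z = of_real pi * of_int n"
    by (simp add: mult.commute)
  then have "z = of_int n"
    by (metis mult_cancel_left of_real_eq_0_iff pi_neq_zero)
  then show False
    using assms by simp
qed

text \<open>Differentiate both sides of Gamma(w) * Gamma(1 - w) = pi / sin(pi w). Each derivative is
  the common function times its logarithmic derivative, and the nonzero common factor
  cancels.\<close>

lemma Digamma_reflection_sin: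
  fixes z :: complex
  assumes "z \<notin> \<int>"
  shows "Digamma (1 - z) - Digamma z = of_real pi * cos (of_real pi * z) / sin (of_real pi * z)"
proof -
  let ?G = "\<lambda>w::complex. Gamma w * Gamma (1 - w)"
  have nonint: "w \<notin> \<int>\<^sub>\<le>\<^sub>0" "1 - w \<notin> \<int>\<^sub>\<le>\<^sub>0" "sin (of_real pi * w) \<noteq> 0"
    if "w \<notin> \<int>" for w :: complex
    using that Ints_diff[of 1 "1 - w"] by (auto simp: sin_pi_times_neq_0 dest: nonpos_Ints_Int)
  have "(?G has_field_derivative ?G z * (Digamma z - Digamma (1 - z))) (at z)"
    using nonint[OF assms]
    by (auto intro!: derivative_eq_intros simp: algebra_simps)
  moreover have "((\<lambda>w. of_real pi / sin (of_real pi * w)) has_field_derivative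
      - ?G z * (of_real pi * cos (of_real pi * z) / sin (of_real pi * z))) (at z)"
    using nonint[OF assms]
    by (auto intro!: derivative_eq_intros simp: Gamma_reflection_complex)
  ultimately have "?G z * (Digamma z - Digamma (1 - z)) =
      ?G z * - (of_real pi * cos (of_real pi * z) / sin (of_real pi * z))"
    unfolding Gamma_reflection_complex mult_minus_right mult_minus_left[symmetric] by (rule DERIV_unique)
  moreover have "?G z \<noteq> 0"
    using nonint[OF assms] by (simp add: Gamma_eq_zero_iff)
  ultimately have "Digamma z - Digamma (1 - z) =
      - (of_real pi * cos (of_real pi * z) / sin (of_real pi * z))"
    by (rule mult_left_cancel[THEN iffD1, rotated])
  from arg_cong[OF this, of uminus] show ?thesis
    by simp
qed

text \<open>Each Digamma value is the limit of a logarithm minus a partial sum of reciprocals; the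
  logarithms cancel in the difference.\<close>

lemma cot_partial_fractions:
  fixes z :: complex
  assumes "z \<notin> \<int>"
  shows "(\<lambda>n. inverse (z + of_nat n) - inverse (1 - z + of_nat n)) sums
    (of_real pi * cos (of_real pi * z) / sin (of_real pi * z))"
proof -
  have "z \<noteq> 0" "1 - z \<noteq> 0"
    using assms by auto
  from tendsto_diff[OF Digamma_LIMSEQ[OF this(2)] Digamma_LIMSEQ[OF this(1)]]
  show ?thesis
    unfolding sums_def Digamma_reflection_sin[OF assms] by (simp add: sum_subtractf)
qed

text \<open>Add the cotangent expansions at (1 + x) / 4 and (1 - x) / 4. With a + b = pi / 2, the
  sum cot a + cot b equals 1 / (sin a * sin b), and 2 * sin a * sin b = cos (a - b).\<close>

lemma sec_partial_fractions:
  fixes x :: complex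
  assumes "norm x < 1"
  shows "(\<lambda>n. 1 / (of_nat (4 * n + 1) + x) + 1 / (of_nat (4 * n + 1) - x)
      - 1 / (of_nat (4 * n + 3) + x) - 1 / (of_nat (4 * n + 3) - x)) sums
    (of_real pi / (2 * cos (of_real pi * x / 2)))"
proof -
  \<comment> \<open>The real part of 1 + y lies strictly between 0 and 2, where there is no multiple
    of 4.\<close>
  have nonint: "(1 + y) / 4 \<notin> \<int>" if "norm y < 1" for y :: complex
  proof
    assume "(1 + y) / 4 \<in> \<int>"
    then obtain k :: int where "(1 + y) / 4 = of_int k"
      by (auto elim: Ints_cases)
    then have "1 + Re y = of_int (4 * k)"
      by (simp add: complex_eq_iff)
    moreover have "\<bar>Re y\<bar> < 1"
      using abs_Re_le_cmod[of y] that by linarith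
    ultimately have "0 < 4 * k" "4 * k < 2"
      by linarith+
    then show False by presburger
  qed
  define a b where "a = of_real pi * ((1 + x) / 4)" and "b = of_real pi * ((1 + - x) / 4)"
  have ab: "sin a \<noteq> 0" "sin b \<noteq> 0"
    unfolding a_def b_def by (intro sin_pi_times_neq_0 nonint; use assms in simp)+
  have "a + b = of_real (pi / 2)" "a - b = of_real pi * x / 2"
    by (simp_all add: a_def b_def field_simps)
  then have "sin (a + b) = 1" "cos (a + b) = 0" "cos (a - b) = cos (of_real pi * x / 2)"
    by (simp_all only: sin_of_real cos_of_real) simp_all
  then have 1: "cos a * sin b + sin a * cos b = 1" "2 * (sin a * sin b) = cos (of_real pi * x / 2)"
    by (simp_all add: sin_add cos_add cos_diff add.commute)
  have "(\<lambda>n. (inverse ((1 + x) / 4 + of_nat n) - inverse (1 - (1 + x) / 4 + of_nat n)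
      + (inverse ((1 + - x) / 4 + of_nat n) - inverse (1 - (1 + - x) / 4 + of_nat n))) / 4) sums
    ((of_real pi * cos a / sin a + of_real pi * cos b / sin b) / 4)"
    unfolding a_def b_def
    by (intro sums_divide sums_add cot_partial_fractions nonint) (use assms in auto)
  moreover have "(of_real pi * cos a / sin a + of_real pi * cos b / sin b) / 4 =
      of_real pi * (cos a * sin b + sin a * cos b) / (4 * (sin a * sin b))"
    using ab by (simp add: field_simps)
  moreover have "\<dots> = of_real pi / (2 * cos (of_real pi * x / 2))"
    unfolding 1 by (simp flip: 1(2))
  moreover have inv: "inverse w / 4 = 1 / (4 * w)" for w :: complex
    by (simp add: field_simps)
  moreover have "4 * ((1 + x) / 4 + of_nat n) = of_nat (4 * n + 1) + x"
    "4 * (1 - (1 + x) / 4 + of_nat n) = of_nat (4 * n + 3) - x"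
    "4 * ((1 + - x) / 4 + of_nat n) = of_nat (4 * n + 1) - x"
    "4 * (1 - (1 + - x) / 4 + of_nat n) = of_nat (4 * n + 3) + x" for n
    by (simp_all add: field_simps)
  ultimately show ?thesis
    by (simp only: add_divide_distrib[of "_ - _"] diff_divide_distrib[of "inverse _"] inv)
      (simp add: add.commute diff_add_eq add_diff_eq diff_diff_eq)
qed

section \<open>The power series of the secant\<close>

text \<open>The two fractions combine to 2 * m / (m^2 - x^2), a geometric series with ratio (x /
  m)^2.\<close>

lemma geometric_partial_fraction:
  fixes x :: "'a :: {real_normed_field, banach}"
  assumes "norm x < 1" "m \<ge> (1::nat)"
  shows "(\<lambda>d. 2 * x ^ (2 * d) / of_nat m ^ (2 * d + 1)) sums
    (1 / (of_nat m + x) + 1 / (of_nat m - x))"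
proof -
  let ?m = "of_nat m :: 'a"
  have m: "?m \<noteq> 0" "norm x < norm ?m"
    using assms by auto
  then have "norm (x / ?m) < 1"
    by (simp add: norm_divide)
  then have "norm ((x / ?m) ^ 2) < 1"
    by (simp add: norm_power power_less_one_iff)
  from sums_mult[OF geometric_sums[OF this], of "2 / ?m"]
  have "(\<lambda>d. 2 * x ^ (2 * d) / ?m ^ (2 * d + 1)) sums (2 / ?m * (1 / (1 - (x / ?m)\<^sup>2)))"
    by (simp add: power_divide power_mult[symmetric])
  moreover have "?m + x \<noteq> 0" "?m - x \<noteq> 0"
    using m(2) by (auto simp: add_eq_0_iff)
  then have "1 / (?m + x) + 1 / (?m - x) = 2 * ?m / ((?m + x) * (?m - x))"
    by (simp add: add_frac_eq)
  moreover have "1 - (x / ?m)\<^sup>2 = (?m + x) * (?m - x) / ?m\<^sup>2"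
    using m(1) by (simp add: field_simps power2_eq_square)
  then have "2 / ?m * (1 / (1 - (x / ?m)\<^sup>2)) = 2 * ?m / ((?m + x) * (?m - x))"
    using m(1) by (simp add: power2_eq_square)
  ultimately show ?thesis
    by simp
qed

text \<open>The double series \<open>g\<close> is summed in both orders: for fixed \<open>n\<close>
  it is the geometric expansion of one group \<open>h n x\<close> of partial fractions, for fixed
  \<open>d\<close> it is the paired beta series.\<close>

lemma sec_power_series:
  fixes x :: complex
  assumes "norm x < 1"
  shows "(\<lambda>d. 2 * of_real (dirichlet_beta (2 * d + 1)) * x ^ (2 * d)) sums
    (of_real pi / (2 * cos (of_real pi * x / 2)))"
proof -
  define c where "c = (\<lambda>n d. 1 / real (4 * n + 1) ^ (2 * d + 1) - 1 / real (4 * n + 3) ^ (2 * d + 1))"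
  have c_nonneg: "c n d \<ge> 0" for n d
    unfolding c_def by (simp add: frac_le power_mono del: power_Suc)
  define g where "g = (\<lambda>(n, d). 2 * of_real (c n d) * x ^ (2 * d))"
  define h :: "nat \<Rightarrow> complex \<Rightarrow> complex" where
    "h = (\<lambda>n y. 1 / (of_nat (4 * n + 1) + y) + 1 / (of_nat (4 * n + 1) - y)
      - 1 / (of_nat (4 * n + 3) + y) - 1 / (of_nat (4 * n + 3) - y))"
  have row: "(\<lambda>d. 2 * of_real (c n d) * y ^ (2 * d)) sums h n y" if "norm y < 1" for n y
  proof -
    have "(\<lambda>d. 2 * y ^ (2 * d) / of_nat (4 * n + 1) ^ (2 * d + 1)
        - 2 * y ^ (2 * d) / of_nat (4 * n + 3) ^ (2 * d + 1)) sums
      (1 / (of_nat (4 * n + 1) + y) + 1 / (of_nat (4 * n + 1) - y)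
        - (1 / (of_nat (4 * n + 3) + y) + 1 / (of_nat (4 * n + 3) - y)))"
      by (intro sums_diff geometric_partial_fraction that) auto
    then show ?thesis
      by (simp add: h_def c_def algebra_simps)
  qed
  \<comment> \<open>Since \<open>c n d \<ge> 0\<close>, absolute summability of \<open>g\<close> is the convergence of the same
    double series at the real point \<open>norm x\<close>, which justifies the exchange of summation.\<close>
  define r where "r = norm x"
  have r: "norm (complex_of_real r) < 1"
    using assms by (simp add: r_def)
  have norm_g: "norm (g (n, d)) = 2 * c n d * r ^ (2 * d)" for n d
    using c_nonneg by (simp add: g_def r_def norm_mult norm_power)
  have row_norm: "(\<lambda>d. norm (g (n, d))) sums Re (h n (of_real r))" for n
    using sums_Re[OF row[OF r, of n]] unfolding norm_g by (simp flip: of_real_power)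
  have row_norm': "((\<lambda>d. norm (g (n, d))) has_sum Re (h n (of_real r))) UNIV" for n
    by (rule sums_nonneg_imp_has_sum[OF row_norm]) auto
  \<comment> \<open>The row sums of the norms are the partial fractions of the secant at the real
    point \<open>r\<close>, whose convergence is already established.\<close>
  have "summable (\<lambda>n. Re (h n (of_real r)))"
    using sums_Re[OF sec_partial_fractions[OF r]] unfolding h_def by (rule sums_summable)
  then have "(\<lambda>n. Re (h n (of_real r))) summable_on UNIV"
    by (rule summable_nonneg_imp_summable_on) (rule has_sum_nonneg[OF row_norm'], simp)
  then have "(\<lambda>p. norm (g p)) summable_on UNIV \<times> UNIV"
    by (intro summable_on_SigmaI[OF row_norm']) auto
  then have "g summable_on UNIV \<times> UNIV"
    by (rule abs_summable_summable)
  then obtain T where T: "(g has_sum T) (UNIV \<times> UNIV)"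
    by (auto simp: summable_on_def)
  have "((\<lambda>d. g (n, d)) has_sum h n x) UNIV" for n
    using row[OF assms, of n] row_norm[of n]
    by (intro norm_summable_imp_has_sum) (auto simp: g_def sums_iff)
  then have "((\<lambda>n. h n x) has_sum T) UNIV"
    using T by (intro has_sum_SigmaD[OF T]) auto
  then have "(\<lambda>n. h n x) sums T"
    by (rule has_sum_imp_sums)
  then have T_eq: "T = of_real pi / (2 * cos (of_real pi * x / 2))"
    using sec_partial_fractions[OF assms] unfolding h_def by (rule sums_unique2)
  have col: "((\<lambda>n. g (n, d)) has_sum (2 * of_real (dirichlet_beta (2 * d + 1)) * x ^ (2 * d))) UNIV" for d
  proof -
    have "(c' has_sum dirichlet_beta (2 * d + 1)) UNIV" if "c' = (\<lambda>n. c n d)" for c'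
      using dirichlet_beta_paired_sums[of "2 * d + 1"] c_nonneg
      by (intro sums_nonneg_imp_has_sum) (auto simp: c_def that)
    then have "((\<lambda>n. complex_of_real (c n d)) has_sum of_real (dirichlet_beta (2 * d + 1))) UNIV"
      by (intro has_sum_of_real) auto
    from has_sum_cmult_right[OF has_sum_cmult_left[OF this, of "x ^ (2 * d)"], of 2]
    show ?thesis
      by (simp add: g_def mult.assoc)
  qed
  have "((\<lambda>(d, n). g (n, d)) has_sum T) (UNIV \<times> UNIV)"
    by (rule iffD1[OF has_sum_swap T])
  then have "((\<lambda>d. 2 * of_real (dirichlet_beta (2 * d + 1)) * x ^ (2 * d)) has_sum T) UNIV"
    by (rule has_sum_SigmaD) (use col in auto)
  then show ?thesis
    unfolding T_eq by (rule has_sum_imp_sums)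
qed

section \<open>Euler numbers and the final evaluation\<close>

text \<open>By uniqueness it suffices that the right-hand side, extended by 0 to odd indices,
  generates 1 / cosh t.\<close>

lemma euler_number_even:
  "euler_number (2 * d) =
    (- 1) ^ d * fact (2 * d) * 2 ^ (2 * d + 2) / pi ^ (2 * d + 1) * dirichlet_beta (2 * d + 1)"
proof -
  define E where "E = (\<lambda>n. if even n then
    (- 1) ^ (n div 2) * fact n * 2 ^ (n + 2) / pi ^ (n + 1) * dirichlet_beta (n + 1) else 0)"
  have "(\<lambda>d. E (2 * d) / fact (2 * d) * t ^ (2 * d)) sums (1 / cosh t)" if "\<bar>t\<bar> < pi / 2" for t
  proof -
    \<comment> \<open>Chosen so that pi * x / 2 = \<i> * t; the disc of radius 1 for
      \<open>x\<close> then matches |t| < pi / 2.\<close>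
    define x where "x = \<i> * complex_of_real (2 * t / pi)"
    have "norm x < 1"
      using that by (simp add: x_def norm_mult norm_divide field_simps)
    moreover have "cos (of_real pi * x / 2) = of_real (cosh t)"
    proof -
      have "of_real pi * x / 2 = \<i> * of_real t"
        by (simp add: x_def)
      then have "cos (of_real pi * x / 2) = cosh (complex_of_real t)"
        by (simp add: cosh_conv_cos)
      also have "\<dots> = of_real (cosh t)"
        by (simp add: cosh_def exp_of_real[symmetric] scaleR_conv_of_real)
      finally show ?thesis .
    qed
    moreover have "x ^ (2 * d) = of_real ((- 1) ^ d * (2 * t / pi) ^ (2 * d))" for d
    proof -
      have "x\<^sup>2 = - of_real ((2 * t / pi)\<^sup>2)"
        unfolding x_def power_mult_distrib by simp
      then show ?thesis
        unfolding power_mult by (simp only: power_minus[of "of_real _"]) simp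
    qed
    ultimately have "(\<lambda>d. complex_of_real (2 * dirichlet_beta (2 * d + 1) * ((- 1) ^ d * (2 * t / pi) ^ (2 * d))))
        sums of_real (pi / (2 * cosh t))"
      using sec_power_series[of x] by simp
    then have "(\<lambda>d. 2 * dirichlet_beta (2 * d + 1) * ((- 1) ^ d * (2 * t / pi) ^ (2 * d)))
        sums (pi / (2 * cosh t))"
      unfolding sums_of_real_iff .
    \<comment> \<open>This normalisation, the leading 2 of the secant series and the powers of 2 /
      pi together give 2 ^ (2 * d + 2) / pi ^ (2 * d + 1).\<close>
    from sums_mult[OF this, of "2 / pi"] show ?thesis
      by (simp add: E_def power_divide power_mult_distrib field_simps)
  qed
  then have "is_euler_numbers E"
    by (auto simp: is_euler_numbers_def E_def)
  then have "euler_number = E"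
    using euler_numbers_unique is_euler_numbers_euler_number by blast
  then have "euler_number (2 * d) = E (2 * d)"
    by simp
  then show ?thesis
    by (simp add: E_def)
qed

theorem theorem12:
  fixes d :: nat
  shows "(\<lambda>n. real_of_int (paperfolding n) / (real n + 1) ^ (2 * d + 1)) sums
           (pi ^ (2 * d + 1) * \<bar>euler_number (2 * d)\<bar> / ((2 ^ (2 * d + 2) - 2) * fact (2 * d)))"
proof -
  let ?b = "dirichlet_beta (2 * d + 1)"
  \<comment> \<open>As beta is nonnegative, the absolute value only removes the sign (- 1) ^
    d.\<close>
  have "\<bar>euler_number (2 * d)\<bar> = fact (2 * d) * 2 ^ (2 * d + 2) / pi ^ (2 * d + 1) * ?b"
    using dirichlet_beta_nonneg[of "2 * d + 1"] unfolding euler_number_even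
    by (simp add: abs_mult power_abs)
  then have "pi ^ (2 * d + 1) * \<bar>euler_number (2 * d)\<bar> / ((2 ^ (2 * d + 2) - 2) * fact (2 * d)) =
      2 ^ (2 * d + 2) * ?b / (2 ^ (2 * d + 2) - 2)"
    by simp
  also have "\<dots> = ?b / (1 - 1 / 2 ^ (2 * d + 1))"
  proof -
    have "(1::real) < 2 ^ (2 * d + 1)"
      by (rule one_less_power) auto
    moreover have "(2::real) ^ (2 * d + 2) = 2 * 2 ^ (2 * d + 1)"
      by simp
    moreover have "2 * q * b / (2 * q - 2) = b / (1 - 1 / q)" if "1 < q" for q b :: real
      using that by (simp add: field_simps)
    ultimately show ?thesis
      by metis
  qed
  finally show ?thesis
    using paperfolding_dirichlet_series[of "2 * d + 1"] by (simp add: add.commute)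
qed

end
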